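(* Suppose the reward distributions $f_1,\dots,f_N$ are all light-tailed. Let $f(t)$, $t=1,2,\dots$, be any positive increasing sequence with $f(t)\to\infty$ as $t\to\infty$. Construct the exploration sequence as follows: for each $t>1$, $t$ is included in $\mathcal A(t)$ if and only if $|\mathcal A(t-1)|<N\lceil f(t)\log t\rceil$. Then the resulting DSEE policy $\pi^*$ has regret $$R_T^{\pi^*}(\mathcal F)=O(f(T)\log T)\quad\text{as }T\to\infty.$$
   Context: Bandit model: there are $N\ge2$ independent arms. Playing arm $n$ at time $t\in\{1,2,\dots\}$ yields a reward $X_n(t)$; for each $n$ the rewards $X_n(1),X_n(2),\dots$ are i.i.d. with unknown distribution $f_n$ and finite mean $\theta_n=\mathbb E[X_n(t)]$. Write $\mathcal F=(f_1,\dots,f_N)$. Let $\sigma$ be a permutation of $\{1,\dots,N\}$ with $\theta_{\sigma(1)}\ge\cdots\ge\theta_{\sigma(N)}$. At each time a single player plays one arm, chosen by a policy $\pi$ from past observations and decisions. The regret is $R_T^\pi(\mathcal F)=T\theta_{\sigma(1)}-\mathbb E_\pi[\sum_{t=1}^T X_\pi(t)]$, where $X_\pi(t)$ is the reward obtained at time $t$ under $\pi$. The constant implied in $O(\cdot)$ may depend on $\mathcal F$, $N$ and the sequence $f$, but not on $T$. Light-tailed: a random variable $X$ is light-tailed if there is $u_0>0$ such that $\mathbb E[\exp(uX)]<\infty$ for all $|u|\le u_0$. DSEE policy: $\mathcal A(t)\subseteq\{1,\dots,t\}$ denotes the (deterministic) set of exploration times up to and including $t$, so $\mathcal A(t)$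 equals $\mathcal A(t-1)$ or $\mathcal A(t-1)\cup\{t\}$, with $\mathcal A(0)=\mathcal A(1)=\emptyset$. For positive integers $k,l$ put $k\oslash l=((k-1)\bmod l)+1$. Let $\overline\theta_n(t)$ be the sample mean of arm $n$ computed from the observations of arm $n$ at times in $\mathcal A(t-1)$ (arbitrary if there are none). At time $t$: if $t\in\mathcal A(t)$, play arm $|\mathcal A(t)|\oslash N$; if $t\notin\mathcal A(t)$, play an arm maximizing $\overline\theta_n(t)$ over $1\le n\le N$ (ties broken arbitrarily). $\log$ is the natural logarithm. *)

theory Defs
  imports "HOL-Probability.Probability"
begin

definition light_tailed :: "'a measure \<Rightarrow> ('a \<Rightarrow> real) \<Rightarrow> bool" where
  "light_tailed M X \<longleftrightarrow>
     (\<exists>u0>0. \<forall>u. \<bar>u\<bar> \<le> u0 \<longrightarrow> integrable M (\<lambda>\<omega>. exp (u * X \<omega>)))"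

definition mean :: "real measure \<Rightarrow> real" where
  "mean D = (\<integral>x. x \<partial>D)"

text \<open>Arms are numbered \<open>1..N\<close> and times start at 1; \<open>X n t\<close> is the reward arm \<open>n\<close> yields
  if it is played at time \<open>t\<close>. Its values for other \<open>n\<close> and \<open>t\<close> are irrelevant.\<close>

definition bandit ::
  "'a measure \<Rightarrow> nat \<Rightarrow> (nat \<Rightarrow> real measure) \<Rightarrow> (nat \<Rightarrow> nat \<Rightarrow> 'a \<Rightarrow> real) \<Rightarrow> bool" where
  "bandit M N F X \<longleftrightarrow>
     prob_space M \<and>
     prob_space.indep_vars M (\<lambda>_. borel) (\<lambda>(n, t). X n t) ({1..N} \<times> {1..}) \<and>
     (\<forall>n\<in>{1..N}. \<forall>t\<ge>1. distr M borel (X n t) = F n)"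

text \<open>A history before time \<open>t\<close> records, for each \<open>s < t\<close>, the arm played at time \<open>s\<close> and the
  reward obtained. A policy maps the time and the history to an arm.\<close>

definition history :: "nat \<Rightarrow> nat \<Rightarrow> (nat \<Rightarrow> nat \<times> real) measure" where
  "history N t = Pi\<^sub>M {1..<t} (\<lambda>_. count_space {1..N} \<Otimes>\<^sub>M borel)"

definition policy :: "nat \<Rightarrow> (nat \<Rightarrow> (nat \<Rightarrow> nat \<times> real) \<Rightarrow> nat) \<Rightarrow> bool" where
  "policy N d \<longleftrightarrow> (\<forall>t\<ge>1. d t \<in> history N t \<rightarrow>\<^sub>M count_space {1..N})"

lemma restrict_fundef_cong [fundef_cong]:
  "A = B \<Longrightarrow> (\<And>x. x \<in> B \<Longrightarrow> g x = h x) \<Longrightarrow> restrict g A = restrict h B"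
  by (auto simp: restrict_def)

fun played ::
  "(nat \<Rightarrow> (nat \<Rightarrow> nat \<times> real) \<Rightarrow> nat) \<Rightarrow> (nat \<Rightarrow> nat \<Rightarrow> 'a \<Rightarrow> real) \<Rightarrow> nat \<Rightarrow> 'a \<Rightarrow> nat" where
  "played d X t \<omega> = d t (\<lambda>s\<in>{1..<t}. (played d X s \<omega>, X (played d X s \<omega>) s \<omega>))"

declare played.simps [simp del]

text \<open>The argument \<open>best\<close> is the largest mean reward.\<close>

definition regret ::
  "'a measure \<Rightarrow> (nat \<Rightarrow> nat \<Rightarrow> 'a \<Rightarrow> real) \<Rightarrow> real \<Rightarrow>
     (nat \<Rightarrow> (nat \<Rightarrow> nat \<times> real) \<Rightarrow> nat) \<Rightarrow> nat \<Rightarrow> real" where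
  "regret M X best d T =
     real T * best - (\<integral>\<omega>. (\<Sum>t=1..T. X (played d X t \<omega>) t \<omega>) \<partial>M)"

text \<open>Only meant for positive \<open>k\<close> and \<open>l\<close>.\<close>

definition oslash :: "nat \<Rightarrow> nat \<Rightarrow> nat"  (infixl "\<oslash>" 70) where
  "k \<oslash> l = (k - 1) mod l + 1"

definition obs_times :: "(nat \<Rightarrow> nat set) \<Rightarrow> nat \<Rightarrow> (nat \<Rightarrow> nat \<times> real) \<Rightarrow> nat \<Rightarrow> nat set" where
  "obs_times A t h n = {s \<in> A (t - 1). fst (h s) = n}"

definition sample_mean :: "(nat \<Rightarrow> nat set) \<Rightarrow> nat \<Rightarrow> (nat \<Rightarrow> nat \<times> real) \<Rightarrow> nat \<Rightarrow> real" where
  "sample_mean A t h n =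
     (\<Sum>s\<in>obs_times A t h n. snd (h s)) / real (card (obs_times A t h n))"

text \<open>The vector \<open>m\<close> below agrees with the sample means of the arms observed so far and is
  arbitrary on the others. Any arm maximizing \<open>m\<close> may be chosen.\<close>

definition dsee ::
  "nat \<Rightarrow> (nat \<Rightarrow> nat set) \<Rightarrow> (nat \<Rightarrow> (nat \<Rightarrow> nat \<times> real) \<Rightarrow> nat) \<Rightarrow> bool" where
  "dsee N A d \<longleftrightarrow> policy N d \<and>
     (\<forall>t\<ge>1. \<forall>h\<in>space (history N t).
        if t \<in> A t then d t h = card (A t) \<oslash> N
        else \<exists>m. (\<forall>n\<in>{1..N}. obs_times A t h n \<noteq> {} \<longrightarrow> m n = sample_mean A t h n) \<and>
                 is_arg_max m (\<lambda>n. n \<in> {1..N}) (d t h))"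

primrec explore :: "nat \<Rightarrow> (nat \<Rightarrow> real) \<Rightarrow> nat \<Rightarrow> nat set" where
  "explore N f 0 = {}"
| "explore N f (Suc t) =
     (if Suc t > 1 \<and>
         int (card (explore N f t)) < int N * \<lceil>f (Suc t) * ln (real (Suc t))\<rceil>
      then explore N f t \<union> {Suc t} else explore N f t)"

end

theory Submission
  imports Defs
begin

text \<open>The regret is the sum over the arms of the gap to the best mean times the expected number of
  plays, because the arm played at time \<open>t\<close> depends only on earlier rewards and so is independent
  of the rewards at time \<open>t\<close>. Exploration contributes \<open>O(f T ln T)\<close> plays. At an
  exploitation time \<open>t\<close> every arm has at least \<open>f t ln t\<close> samples at deterministic times, so by
  a Chernoff bound a suboptimal arm is played with probability at most \<open>2 exp (- a f t ln t)\<close>;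
  since \<open>a f t\<close> eventually exceeds 2, these probabilities are summable.\<close>

section \<open>Exponential tail bounds for i.i.d. sums with negative mean\<close>

text \<open>By convexity the difference quotients of \<open>u \<mapsto> exp (u * Y)\<close> at 0 are dominated, so the
  moment generating function has derivative \<open>E Y < 0\<close> at 0.\<close>

lemma exp_moment_less_one:
  assumes "prob_space M" "integrable M Y" "(\<integral>x. Y x \<partial>M) < (0::real)"
    and "u0 > 0" "integrable M (\<lambda>x. exp (u0 * Y x))"
  obtains u where "u > 0" "integrable M (\<lambda>x. exp (u * Y x))" "(\<integral>x. exp (u * Y x) \<partial>M) < 1"
proof -
  interpret prob_space M by fact
  have [measurable]: "Y \<in> borel_measurable M" using assms(2) by auto
  define v where "v k = u0 / real (Suc k)" for k
  have v: "v k > 0" "v k \<le> u0" for k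
    using \<open>u0 > 0\<close> by (auto simp: v_def field_simps)
  define s where "s k x = (exp (v k * Y x) - 1) / v k" for k x
  \<comment> \<open>The quotient lies between its limit \<open>Y x\<close> and its value at
    \<open>u0\<close>; \<open>w\<close> adds bounds on the absolute values of both.\<close>
  define w where "w x = \<bar>Y x\<bar> + exp (u0 * Y x) / u0 + 1 / u0" for x
  have lower: "Y x \<le> s k x" for k x
    using exp_ge_add_one_self[of "v k * Y x"] v[of k] by (simp add: s_def field_simps)
  have upper: "s k x \<le> (exp (u0 * Y x) - 1) / u0" for k x
  proof -
    \<comment> \<open>\<open>v k * Y x\<close> is the convex combination of 0 and
      \<open>u0 * Y x\<close> with weight \<open>v k / u0\<close>.\<close>
    have "exp ((1 - v k / u0) *\<^sub>R 0 + (v k / u0) *\<^sub>R (u0 * Y x))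
        \<le> (1 - v k / u0) * exp 0 + (v k / u0) * exp (u0 * Y x)"
      by (rule convex_onD[OF exp_convex]) (use v[of k] \<open>u0 > 0\<close> in auto)
    moreover have "(v k / u0) *\<^sub>R (u0 * Y x) = v k * Y x"
      using \<open>u0 > 0\<close> by simp
    ultimately have "exp (v k * Y x) - 1 \<le> v k * ((exp (u0 * Y x) - 1) / u0)"
      by (simp add: diff_divide_distrib right_diff_distrib)
    then show ?thesis using v(1)[of k] by (simp add: s_def field_simps)
  qed
  have bound: "norm (s k x) \<le> w x" for k x
  proof -
    have "(exp (u0 * Y x) - 1) / u0 \<le> exp (u0 * Y x) / u0 + 1 / u0" "exp (u0 * Y x) / u0 + 1 / u0 \<ge> 0"
      using \<open>u0 > 0\<close> by (simp_all add: field_simps add_nonneg_nonneg)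
    then show ?thesis using lower[of x k] upper[of k x] unfolding w_def real_norm_def by linarith
  qed
  have lim: "(\<lambda>k. s k x) \<longlonglongrightarrow> Y x" for x
  proof -
    have "((\<lambda>h. exp (h * Y x)) has_real_derivative Y x) (at 0)"
      by (auto intro!: derivative_eq_intros)
    then have "((\<lambda>h. (exp (h * Y x) - 1) / h) \<longlongrightarrow> Y x) (at 0)"
      by (simp add: has_field_derivative_iff)
    moreover have "filterlim v (at 0) sequentially"
    proof -
      have "v \<longlonglongrightarrow> 0"
        unfolding v_def using LIMSEQ_Suc[OF lim_const_over_n[of u0]] by simp
      then show ?thesis
        using v(1) by (auto simp: filterlim_at less_imp_neq[symmetric])
    qed
    ultimately show ?thesis
      unfolding s_def by (rule filterlim_compose)
  qed
  have wint: "integrable M w"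
    unfolding w_def using assms by auto
  have [measurable]: "\<And>k. s k \<in> borel_measurable M" unfolding s_def by measurable
  have sint: "integrable M (s k)" for k
    by (rule Bochner_Integration.integrable_bound[OF wint]) (use bound in \<open>auto intro: order_trans[OF _ abs_ge_self]\<close>)
  have "(\<lambda>k. \<integral>x. s k x \<partial>M) \<longlonglongrightarrow> (\<integral>x. Y x \<partial>M)"
    by (rule integral_dominated_convergence[where w = w]) (use wint lim bound in auto)
  then have "\<forall>\<^sub>F k in sequentially. (\<integral>x. s k x \<partial>M) < 0"
    using assms(3) by (rule order_tendstoD)
  then obtain k where k: "(\<integral>x. s k x \<partial>M) < 0"
    by (auto simp: eventually_sequentially)
  \<comment> \<open>Solving the quotient for the exponential transfers integrability from
    \<open>s k\<close> and turns its negative integral into a moment below 1.\<close>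
  have eq: "exp (v k * Y x) = v k * s k x + 1" for x
    using v(1)[of k] by (simp add: s_def)
  have "(\<integral>x. exp (v k * Y x) \<partial>M) = v k * (\<integral>x. s k x \<partial>M) + 1"
    unfolding eq using sint by (simp add: prob_space)
  moreover have "v k * (\<integral>x. s k x \<partial>M) < 0"
    using v(1) k by (simp add: mult_pos_neg)
  ultimately show thesis
    using that[of "v k"] v(1) sint unfolding eq by simp
qed

text \<open>If \<open>q\<close> is the expectation of \<open>exp (u * g)\<close> for a
  \<open>u > 0\<close> with \<open>q < 1\<close>, Markov's inequality for the exponential of the sum
  and independence give the bound \<open>q ^ card J\<close>. The rate \<open>a\<close> is fixed
  before \<open>M\<close>, \<open>Z\<close> and \<open>J\<close>, so that the final constant is
  uniform over all bandits with the same reward distributions.\<close>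

lemma chernoff_iid:
  fixes g :: "real \<Rightarrow> real"
  assumes "real_distribution D" and [measurable]: "g \<in> borel_measurable borel"
    and "integrable D g" "(\<integral>x. g x \<partial>D) < 0"
    and "u0 > 0" "integrable D (\<lambda>x. exp (u0 * g x))"
  obtains a where "a > 0"
    "\<And>(M :: 'a measure) (Z :: 'i \<Rightarrow> 'a \<Rightarrow> real) J. prob_space M \<Longrightarrow> finite J \<Longrightarrow>
       prob_space.indep_vars M (\<lambda>_. borel) Z J \<Longrightarrow> (\<And>i. i \<in> J \<Longrightarrow> distr M borel (Z i) = D) \<Longrightarrow>
       measure M {\<omega> \<in> space M. 0 \<le> (\<Sum>i\<in>J. g (Z i \<omega>))} \<le> exp (- a * real (card J))"
proof -
  interpret D: real_distribution D by fact
  obtain u where u: "u > 0" "integrable D (\<lambda>x. exp (u * g x))" "(\<integral>x. exp (u * g x) \<partial>D) < 1"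
    using exp_moment_less_one[OF D.prob_space_axioms assms(3-6)] by blast
  define q where "q = (\<integral>x. exp (u * g x) \<partial>D)"
  have q: "q \<ge> 0" "q < 1" using u by (auto simp: q_def)
  show thesis
  proof (rule that[of "1 - q"])
    show "1 - q > 0" using q by simp
  next
    fix M :: "'a measure" and Z :: "'i \<Rightarrow> 'a \<Rightarrow> real" and J :: "'i set"
    assume "prob_space M" and J: "finite J"
      and ind: "prob_space.indep_vars M (\<lambda>_. borel) Z J"
      and D: "\<And>i. i \<in> J \<Longrightarrow> distr M borel (Z i) = D"
    interpret prob_space M by fact
    have Z: "\<And>i. i \<in> J \<Longrightarrow> Z i \<in> borel_measurable M"
      using ind by (auto simp: indep_vars_def)
    have eint: "integrable M (\<lambda>\<omega>. exp (u * g (Z i \<omega>)))" if "i \<in> J" for i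
      using integrable_distr[OF Z[OF that], of "\<lambda>x. exp (u * g x)"] u(2) D[OF that] by simp
    have eval: "(\<integral>\<omega>. exp (u * g (Z i \<omega>)) \<partial>M) = q" if "i \<in> J" for i
      using integral_distr[OF Z[OF that], of "\<lambda>x. exp (u * g x)"] D[OF that] by (simp add: q_def)
    have ind': "indep_vars (\<lambda>_. borel) (\<lambda>i \<omega>. exp (u * g (Z i \<omega>))) J"
      by (rule indep_vars_compose2[OF ind, of "\<lambda>_ x. exp (u * g x)"]) measurable
    have expand: "(\<Prod>i\<in>J. exp (u * g (Z i \<omega>))) = exp (u * (\<Sum>i\<in>J. g (Z i \<omega>)))" for \<omega>
      by (simp add: exp_sum[OF J] sum_distrib_left)
    have pint: "integrable M (\<lambda>\<omega>. exp (u * (\<Sum>i\<in>J. g (Z i \<omega>))))"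
      using indep_vars_integrable[OF J ind' eint] by (simp add: expand)
    have pval: "(\<integral>\<omega>. exp (u * (\<Sum>i\<in>J. g (Z i \<omega>))) \<partial>M) = q ^ card J"
      using indep_vars_lebesgue_integral[OF J ind' eint] by (simp add: expand eval)
    have "measure M {\<omega> \<in> space M. 0 \<le> (\<Sum>i\<in>J. g (Z i \<omega>))}
        = measure M {\<omega> \<in> space M. 1 \<le> exp (u * (\<Sum>i\<in>J. g (Z i \<omega>)))}"
      using \<open>u > 0\<close> by (simp add: zero_le_mult_iff)
    also have "\<dots> \<le> (\<integral>\<omega>. exp (u * (\<Sum>i\<in>J. g (Z i \<omega>))) \<partial>M) / 1"
      by (rule integral_Markov_inequality_measure[OF pint, where A = "{}"]) auto
    also have "\<dots> = q ^ card J" by (simp add: pval)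
    \<comment> \<open>By 1 + x \<le> exp x. The rate \<open>1 - q\<close> is positive even if
      \<open>q = 0\<close>, where a logarithm of \<open>q\<close> would not serve.\<close>
    also have "\<dots> \<le> exp (- (1 - q)) ^ card J"
      using exp_ge_add_one_self[of "- (1 - q)"] q by (intro power_mono) auto
    also have "\<dots> = exp (- (1 - q) * real (card J))"
      by (simp add: exp_of_nat_mult[symmetric] mult.commute)
    finally show "measure M {\<omega> \<in> space M. 0 \<le> (\<Sum>i\<in>J. g (Z i \<omega>))} \<le> exp (- (1 - q) * real (card J))" .
  qed
qed

section \<open>Counting the exploration times\<close>

lemma finite_explore [simp]: "finite (explore N f t)"
  by (induction t) auto

lemma explore_subset: "explore N f t \<subseteq> {2..t}"
  by (induction t) (auto split: if_splits)

lemma explore_mono: "s \<le> t \<Longrightarrow> explore N f s \<subseteq> explore N f t"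
  by (rule lift_Suc_mono_le[of "explore N f"]) auto

lemma explore_at: "s \<in> explore N f t \<Longrightarrow> s \<in> explore N f s"
proof (induction t)
  case (Suc t)
  then show ?case by (cases "s = Suc t") (auto split: if_splits)
qed simp

text \<open>The count grows by exactly one at each exploration time, so along these times it skips
  no value. This is what makes exploration a round robin over the arms.\<close>

lemma card_explore_image: "(\<lambda>s. card (explore N f s)) ` explore N f t = {1..card (explore N f t)}"
proof (induction t)
  case (Suc t)
  have "Suc t \<notin> explore N f t" using explore_subset[of N f t] by auto
  then show ?case using Suc by (auto simp: atLeastAtMostSuc_conv simp del: One_nat_def)
qed simp

text \<open>A time is added only while the count is strictly below the integer threshold, so one
  more element cannot exceed it; otherwise the earlier bound persists because the threshold is
  nondecreasing. At time 1 both sides are 0.\<close>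

lemma card_explore_le:
  assumes "\<And>t. t \<ge> 1 \<Longrightarrow> f t > 0" "mono_on {1..} f" "t \<ge> 1"
  shows "int (card (explore N f t)) \<le> int N * \<lceil>f t * ln (real t)\<rceil>"
  using \<open>t \<ge> 1\<close>
proof (induction t rule: dec_induct)
  case base
  then show ?case by simp
next
  case (step t)
  have "Suc t \<notin> explore N f t" using explore_subset[of N f t] by auto
  have "f t * ln (real t) \<le> f (Suc t) * ln (real (Suc t))"
    using step assms by (intro mult_mono) (auto simp: mono_on_def intro: less_imp_le)
  then have "int N * \<lceil>f t * ln (real t)\<rceil> \<le> int N * \<lceil>f (Suc t) * ln (real (Suc t))\<rceil>"
    by (intro mult_left_mono ceiling_mono) auto
  then show ?case using step \<open>Suc t \<notin> _\<close> by auto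
qed

text \<open>The sampling times of arm \<open>n\<close> before \<open>t\<close>, computed from the
  counts alone. The set is deterministic, hence the rewards collected there are i.i.d.\<close>

definition arm_times :: "nat \<Rightarrow> (nat \<Rightarrow> real) \<Rightarrow> nat \<Rightarrow> nat \<Rightarrow> nat set" where
  "arm_times N f n t = {s \<in> explore N f (t - 1). card (explore N f s) \<oslash> N = n}"

text \<open>If \<open>t\<close> is not explored, the count has already reached \<open>N * m\<close>.
  Among the counts up to \<open>N * m\<close>, arm \<open>n\<close> owns the \<open>m\<close> values
  \<open>i * N + n\<close> with \<open>i < m\<close>, and each of them is attained.\<close>

lemma card_arm_times:
  assumes "n \<in> {1..N}" "t \<ge> 2" "t \<notin> explore N f t"
  shows "f t * ln (real t) \<le> real (card (arm_times N f n t))"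
proof -
  define m where "m = nat \<lceil>f t * ln (real t)\<rceil>"
  obtain t' where t': "t = Suc t'" "t' \<ge> 1" using assms(2) by (cases t) auto
  \<comment> \<open>As \<open>t\<close> is at least 2, the guard \<open>Suc t' > 1\<close> holds, so
    \<open>t\<close> can only have been rejected because of the count.\<close>
  have "\<not> int (card (explore N f t')) < int N * \<lceil>f t * ln (real t)\<rceil>"
    using assms(3) t' by (auto split: if_splits)
  \<comment> \<open>For a negative ceiling \<open>nat\<close> gives \<open>m = 0\<close> and the
    claim is trivial.\<close>
  then have "int N * int m \<le> int (card (explore N f t'))"
    by (cases "\<lceil>f t * ln (real t)\<rceil> \<ge> 0") (auto simp: m_def)
  then have K: "N * m \<le> card (explore N f t')"
    by (metis of_nat_le_iff of_nat_mult)
  have "(\<lambda>i. i * N + n) ` {..<m} \<subseteq> (\<lambda>s. card (explore N f s)) ` arm_times N f n t"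
  proof (rule image_subsetI)
    fix i assume "i \<in> {..<m}"
    then have "Suc i * N \<le> m * N" by (intro mult_right_mono) auto
    then have "i * N + n \<in> {1..card (explore N f t')}"
      using K assms(1) by (simp add: mult.commute)
    then obtain s where s: "s \<in> explore N f t'" "card (explore N f s) = i * N + n"
      unfolding card_explore_image[symmetric] by auto
    have "(i * N + n) \<oslash> N = n"
    proof -
      have "i * N + n - 1 = (n - 1) + i * N" using assms(1) by simp
      moreover have "(n - 1) mod N = n - 1" using assms(1) by (intro mod_less) auto
      ultimately show ?thesis
        using assms(1) by (simp only: oslash_def mod_mult_self1) simp
    qed
    then show "i * N + n \<in> (\<lambda>s. card (explore N f s)) ` arm_times N f n t"
      using s t' by (intro image_eqI[of _ _ s]) (auto simp: arm_times_def)
  qed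
  then have "card ((\<lambda>i. i * N + n) ` {..<m}) \<le> card (arm_times N f n t)"
    by (rule surj_card_le[rotated]) (simp add: arm_times_def)
  moreover have "card ((\<lambda>i. i * N + n) ` {..<m}) = m"
    using assms(1) by (subst card_image) (auto simp: inj_on_def)
  ultimately have "m \<le> card (arm_times N f n t)" by simp
  then show ?thesis unfolding m_def by linarith
qed


section \<open>Histories, and measurability of the arm played\<close>

text \<open>The random history that the policy produces; naming it turns the recursion for
  \<open>played\<close> into an application of \<open>d t\<close>.\<close>

definition past ::
  "(nat \<Rightarrow> (nat \<Rightarrow> nat \<times> real) \<Rightarrow> nat) \<Rightarrow> (nat \<Rightarrow> nat \<Rightarrow> 'a \<Rightarrow> real) \<Rightarrow> nat \<Rightarrow> 'a \<Rightarrow> nat \<Rightarrow> nat \<times> real"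
  where "past d X t \<omega> = (\<lambda>s\<in>{1..<t}. (played d X s \<omega>, X (played d X s \<omega>) s \<omega>))"

lemma played_past: "played d X t \<omega> = d t (past d X t \<omega>)"
  by (simp add: played.simps[of d X t \<omega>] past_def)

text \<open>Strong induction on the time. The measure \<open>K\<close> is general because three are
  used: \<open>M\<close>, the product space carrying only the rewards before \<open>t\<close> (for
  independence), and a discrete space.\<close>

lemma measurable_past:
  assumes "policy N d" and X: "\<And>n s. n \<in> {1..N} \<Longrightarrow> 1 \<le> s \<Longrightarrow> s < t \<Longrightarrow> X n s \<in> borel_measurable K"
  shows "past d X t \<in> K \<rightarrow>\<^sub>M history N t"
  using X
proof (induction t rule: less_induct)
  case (less t)
  have played: "played d X s \<in> K \<rightarrow>\<^sub>M count_space {1..N}" if "1 \<le> s" "s < t" for s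
  proof -
    have "d s \<in> history N s \<rightarrow>\<^sub>M count_space {1..N}"
      using \<open>policy N d\<close> that by (auto simp: policy_def)
    from measurable_compose[OF less.IH this] less.prems that show ?thesis
      by (simp add: played_past[abs_def])
  qed
  show ?case
    unfolding past_def history_def
  proof (intro measurable_restrict measurable_Pair)
    fix s assume "s \<in> {1..<t}"
    then show "played d X s \<in> K \<rightarrow>\<^sub>M count_space {1..N}" using played by simp
    \<comment> \<open>The arm index is itself random; since it takes finitely many values, the
      measurable pieces can be glued.\<close>
    show "(\<lambda>\<omega>. X (played d X s \<omega>) s \<omega>) \<in> borel_measurable K"
    proof (rule measurable_compose_countable'[where f = "\<lambda>n. X n s" and I = "{1..N}"])
      show "X n s \<in> borel_measurable K" if "n \<in> {1..N}" for n
        using \<open>s \<in> {1..<t}\<close> that by (intro less.prems) auto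
      show "played d X s \<in> K \<rightarrow>\<^sub>M count_space {1..N}" using \<open>s \<in> {1..<t}\<close> played by simp
    qed simp
  qed
qed

lemma measurable_played:
  assumes "policy N d" "t \<ge> 1"
    and "\<And>n s. n \<in> {1..N} \<Longrightarrow> 1 \<le> s \<Longrightarrow> s < t \<Longrightarrow> X n s \<in> borel_measurable K"
  shows "played d X t \<in> K \<rightarrow>\<^sub>M count_space {1..N}"
proof -
  have "d t \<in> history N t \<rightarrow>\<^sub>M count_space {1..N}"
    using assms(1,2) by (auto simp: policy_def)
  moreover have "past d X t \<in> K \<rightarrow>\<^sub>M history N t"
    using assms(3) by (rule measurable_past[OF assms(1)])
  ultimately show ?thesis
    unfolding played_past[abs_def] by (rule measurable_compose[rotated])
qed

text \<open>On the discrete space every reward is measurable, so measurability of the history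
  reduces to plain membership for every outcome.\<close>

lemma past_in_space: "policy N d \<Longrightarrow> past d X t \<omega> \<in> space (history N t)"
  using measurable_space[OF measurable_past[of N d t X "count_space UNIV"], of \<omega>] by simp

lemma played_in: "policy N d \<Longrightarrow> t \<ge> 1 \<Longrightarrow> played d X t \<omega> \<in> {1..N}"
  using measurable_space[OF measurable_played[of N d t X "count_space UNIV"], of \<omega>] by simp

text \<open>Expresses the arm played at time \<open>t\<close> as a function of the rewards before time \<open>t\<close>,
  by running the policy on the coordinate process.\<close>

lemma played_restrict:
  assumes "policy N d" "1 \<le> t" "t \<le> T"
  shows "played d (\<lambda>n s w. w (n, s)) t (\<lambda>i\<in>{1..N} \<times> {1..<T}. X (fst i) (snd i) \<omega>) = played d X t \<omega>"
proof -
  define w where "w = (\<lambda>i\<in>{1..N} \<times> {1..<T}. X (fst i) (snd i) \<omega>)"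
  have "played d (\<lambda>n s w. w (n, s)) t w = played d X t \<omega>"
    using assms(2,3)
  proof (induction t rule: less_induct)
    case (less t)
    have "past d (\<lambda>n s w. w (n, s)) t w = past d X t \<omega>"
      unfolding past_def
    proof (rule restrict_ext)
      fix s assume s: "s \<in> {1..<t}"
      then have "played d (\<lambda>n s w. w (n, s)) s w = played d X s \<omega>"
        using less by simp
      \<comment> \<open>\<open>w\<close> is a reward only on its index set; the pair lies there
        because the arm is in \<open>{1..N}\<close> and \<open>s < t \<le> T\<close>.\<close>
      moreover have "w (played d X s \<omega>, s) = X (played d X s \<omega>) s \<omega>"
        using s less.prems played_in[OF assms(1), of s X \<omega>] by (simp add: w_def)
      ultimately show "(played d (\<lambda>n s w. w (n, s)) s w, w (played d (\<lambda>n s w. w (n, s)) s w, s)) =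
        (played d X s \<omega>, X (played d X s \<omega>) s \<omega>)"
        by simp
    qed
    then show ?case by (simp add: played_past)
  qed
  then show ?thesis by (simp only: w_def)
qed

section \<open>Regret decomposition for an arbitrary policy\<close>

locale bandit_policy = prob_space M
  for M :: "'a measure" +
  fixes N :: nat and F :: "nat \<Rightarrow> real measure" and X :: "nat \<Rightarrow> nat \<Rightarrow> 'a \<Rightarrow> real"
    and d :: "nat \<Rightarrow> (nat \<Rightarrow> nat \<times> real) \<Rightarrow> nat"
  assumes bandit: "bandit M N F X" and policy: "policy N d"
    and integrable_F: "\<And>n. n \<in> {1..N} \<Longrightarrow> integrable (F n) (\<lambda>x. x)"
begin

lemma indep_rewards: "indep_vars (\<lambda>_. borel) (\<lambda>(n, t). X n t) ({1..N} \<times> {1..})"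
  using bandit by (simp add: bandit_def)

lemma distr_reward: "n \<in> {1..N} \<Longrightarrow> t \<ge> 1 \<Longrightarrow> distr M borel (X n t) = F n"
  using bandit by (simp add: bandit_def)

lemma measurable_reward: "n \<in> {1..N} \<Longrightarrow> t \<ge> 1 \<Longrightarrow> X n t \<in> borel_measurable M"
  using indep_rewards by (auto simp: indep_vars_def)

lemma measurable_arm: "t \<ge> 1 \<Longrightarrow> played d X t \<in> M \<rightarrow>\<^sub>M count_space {1..N}"
  by (rule measurable_played[OF policy]) (auto intro: measurable_reward)

lemma integrable_reward: "n \<in> {1..N} \<Longrightarrow> t \<ge> 1 \<Longrightarrow> integrable M (X n t)"
  using integrable_distr[OF measurable_reward, of n t "\<lambda>x. x"] integrable_F by (simp add: distr_reward)

lemma expectation_reward: "n \<in> {1..N} \<Longrightarrow> t \<ge> 1 \<Longrightarrow> expectation (X n t) = mean (F n)"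
  using integral_distr[OF measurable_reward, of n t "\<lambda>x. x"] by (simp add: distr_reward mean_def)

abbreviation arm_prob :: "nat \<Rightarrow> nat \<Rightarrow> real" where
  "arm_prob n t \<equiv> prob {\<omega> \<in> space M. played d X t \<omega> = n}"

lemma arm_event: "t \<ge> 1 \<Longrightarrow> {\<omega> \<in> space M. played d X t \<omega> = n} \<in> events"
proof -
  assume t: "t \<ge> 1"
  have "{\<omega> \<in> space M. played d X t \<omega> = n} = played d X t -` ({n} \<inter> {1..N}) \<inter> space M"
    using played_in[OF policy t, of X] by auto
  also have "\<dots> \<in> events"
    by (rule measurable_sets[OF measurable_arm[OF t]]) auto
  finally show ?thesis .
qed

lemma sum_arm_prob: "t \<ge> 1 \<Longrightarrow> (\<Sum>n=1..N. arm_prob n t) = 1"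
proof -
  assume t: "t \<ge> 1"
  have "(\<Sum>n=1..N. arm_prob n t) = prob (\<Union>n\<in>{1..N}. {\<omega> \<in> space M. played d X t \<omega> = n})"
    by (rule finite_measure_finite_Union[symmetric])
      (use arm_event[OF t] in \<open>auto simp: disjoint_family_on_def\<close>)
  also have "(\<Union>n\<in>{1..N}. {\<omega> \<in> space M. played d X t \<omega> = n}) = space M"
    using played_in[OF policy t, of X] by auto
  finally show ?thesis by (simp add: prob_space)
qed

text \<open>The arm at time \<open>t\<close> is a measurable function of the rewards indexed by
  \<open>?A\<close>, which is disjoint from the index \<open>(n, t)\<close>. Disjoint blocks of an
  independent family are independent. The indicator makes the event real-valued, as the product rule
  for expectations requires.\<close>

lemma indep_arm_reward:
  assumes "n \<in> {1..N}" "t \<ge> 1"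
  shows "indep_var borel (\<lambda>\<omega>. indicator {n} (played d X t \<omega>) :: real) borel (X n t)"
proof -
  let ?A = "{1..N} \<times> {1..<t}" and ?B = "{(n, t)}"
  let ?played = "played d (\<lambda>n s w. w (n, s)) t"
  have "?played \<in> PiM ?A (\<lambda>_. borel :: real measure) \<rightarrow>\<^sub>M count_space {1..N}"
    using assms by (intro measurable_played[OF policy]) auto
  then have "(\<lambda>w. indicator {n} (?played w) :: real) \<in> borel_measurable (PiM ?A (\<lambda>_. borel))"
    by (rule measurable_compose) simp
  note 1 = this
  have 2: "(\<lambda>w. w (n, t)) \<in> borel_measurable (PiM ?B (\<lambda>_. borel :: real measure))"
    by simp
  have "indep_var
      (PiM ?A (\<lambda>_. borel)) (\<lambda>\<omega>. restrict (\<lambda>i. (case i of (n, t) \<Rightarrow> X n t) \<omega>) ?A)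
      (PiM ?B (\<lambda>_. borel)) (\<lambda>\<omega>. restrict (\<lambda>i. (case i of (n, t) \<Rightarrow> X n t) \<omega>) ?B)"
    using assms by (intro indep_var_restrict[OF indep_rewards]) auto
  note indep_var_compose[OF this 1 2]
  moreover have "(\<lambda>w. indicator {n} (?played w) :: real) \<circ> (\<lambda>\<omega>. \<lambda>i\<in>?A. (case i of (n, t) \<Rightarrow> X n t) \<omega>)
      = (\<lambda>\<omega>. indicator {n} (played d X t \<omega>))"
    unfolding comp_def case_prod_beta using played_restrict[OF policy \<open>t \<ge> 1\<close> order_refl, of X]
    by (simp only:)
  moreover have "(\<lambda>w. w (n, t)) \<circ> (\<lambda>\<omega>. \<lambda>i\<in>?B. (case i of (n, t) \<Rightarrow> X n t) \<omega>) = X n t"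
    by (simp add: fun_eq_iff)
  ultimately show ?thesis by (simp only:)
qed

text \<open>Exactly one indicator is 1 for each outcome, so the reward is a finite sum of products
  whose expectations factor by independence.\<close>

lemma
  assumes "t \<ge> 1"
  shows integrable_played: "integrable M (\<lambda>\<omega>. X (played d X t \<omega>) t \<omega>)"
    and expectation_played:
      "expectation (\<lambda>\<omega>. X (played d X t \<omega>) t \<omega>) = (\<Sum>n=1..N. mean (F n) * arm_prob n t)"
proof -
  let ?I = "\<lambda>n \<omega>. indicator {n} (played d X t \<omega>) :: real"
  have split: "X (played d X t \<omega>) t \<omega> = (\<Sum>n=1..N. ?I n \<omega> * X n t \<omega>)" for \<omega>
  proof -
    have "(\<Sum>n=1..N. ?I n \<omega> * X n t \<omega>)
        = (\<Sum>n=1..N. if played d X t \<omega> = n then X n t \<omega> else 0)"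
      by (intro sum.cong) (auto simp: indicator_def)
    then show ?thesis
      using played_in[OF policy assms, of X \<omega>] by simp
  qed
  have I: "integrable M (?I n)" "expectation (?I n) = arm_prob n t" for n
  proof -
    let ?E = "{\<omega> \<in> space M. played d X t \<omega> = n}"
    have *: "\<And>\<omega>. \<omega> \<in> space M \<Longrightarrow> ?I n \<omega> = indicator ?E \<omega>"
      by (auto simp: indicator_def)
    have "integrable M (indicator ?E :: 'a \<Rightarrow> real)"
      using arm_event[OF assms] by (simp add: less_top[symmetric])
    then show "integrable M (?I n)"
      using * by (subst Bochner_Integration.integrable_cong[OF refl *]) auto
    show "expectation (?I n) = arm_prob n t"
      using arm_event[OF assms, of n]
      by (subst Bochner_Integration.integral_cong[OF refl *]) auto
  qed
  have "integrable M (\<lambda>\<omega>. ?I n \<omega> * X n t \<omega>)" if "n \<in> {1..N}" for n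
    by (rule indep_var_integrable[OF indep_arm_reward[OF that assms] I(1)
        integrable_reward[OF that assms]])
  note int = this
  show "integrable M (\<lambda>\<omega>. X (played d X t \<omega>) t \<omega>)"
    unfolding split using int by (intro Bochner_Integration.integrable_sum) auto
  have "expectation (\<lambda>\<omega>. ?I n \<omega> * X n t \<omega>) = mean (F n) * arm_prob n t" if "n \<in> {1..N}" for n
    using indep_var_lebesgue_integral[OF indep_arm_reward[OF that assms] I(1)
        integrable_reward[OF that assms]] expectation_reward[OF that assms] I(2)[of n] by simp
  then show "expectation (\<lambda>\<omega>. X (played d X t \<omega>) t \<omega>) = (\<Sum>n=1..N. mean (F n) * arm_prob n t)"
    unfolding split by (subst Bochner_Integration.integral_sum[OF int]) auto
qed

lemma regret_eq:
  "regret M X \<theta> d T = (\<Sum>n=1..N. (\<theta> - mean (F n)) * (\<Sum>t=1..T. arm_prob n t))"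
proof -
  have "regret M X \<theta> d T = (\<Sum>t=1..T. \<theta> - (\<Sum>n=1..N. mean (F n) * arm_prob n t))"
    unfolding regret_def
    by (subst Bochner_Integration.integral_sum)
      (auto simp: integrable_played expectation_played sum_subtractf)
  \<comment> \<open>The arm probabilities at each time sum to 1, so \<open>\<theta>\<close> can be
    distributed over the arms.\<close>
  also have "\<dots> = (\<Sum>t=1..T. \<Sum>n=1..N. (\<theta> - mean (F n)) * arm_prob n t)"
    by (intro sum.cong refl)
      (simp add: left_diff_distrib sum_subtractf sum_distrib_left[symmetric] sum_arm_prob del: One_nat_def)
  also have "\<dots> = (\<Sum>n=1..N. (\<theta> - mean (F n)) * (\<Sum>t=1..T. arm_prob n t))"
    by (subst sum.swap) (simp add: sum_distrib_left)
  finally show ?thesis .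
qed

end

section \<open>Error probabilities of DSEE at exploitation times\<close>

lemma played_explore:
  assumes "dsee N (explore N f) d" "s \<ge> 1" "s \<in> explore N f s"
  shows "played d X s \<omega> = card (explore N f s) \<oslash> N"
  using assms past_in_space[of N d X s \<omega>] by (auto simp: dsee_def played_past)

text \<open>Choices at exploration times follow the counts and not the rewards, so the recorded arms
  are the same for every outcome.\<close>

lemma obs_times_past:
  assumes "dsee N (explore N f) d" "t \<ge> 1"
  shows "obs_times (explore N f) t (past d X t \<omega>) n = arm_times N f n t"
proof -
  have "fst (past d X t \<omega> s) = card (explore N f s) \<oslash> N" if "s \<in> explore N f (t - 1)" for s
  proof -
    \<comment> \<open>This places \<open>s\<close> in the domain \<open>{1..<t}\<close> of the
      history, outside of which it is \<open>undefined\<close>.\<close>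
    have "s \<in> {2..t - 1}" using that explore_subset by blast
    then have "s \<in> {1..<t}" by auto
    then show ?thesis
      using played_explore[OF assms(1) _ explore_at[OF that]] by (simp add: past_def)
  qed
  then show ?thesis by (auto simp: obs_times_def arm_times_def)
qed

lemma sample_mean_past:
  assumes "dsee N (explore N f) d" "t \<ge> 1"
  shows "sample_mean (explore N f) t (past d X t \<omega>) n =
    (\<Sum>s\<in>arm_times N f n t. X n s \<omega>) / real (card (arm_times N f n t))"
proof -
  have "snd (past d X t \<omega> s) = X n s \<omega>" if "s \<in> arm_times N f n t" for s
  proof -
    have s: "s \<in> explore N f (t - 1)" "card (explore N f s) \<oslash> N = n"
      using that by (auto simp: arm_times_def)
    have "s \<in> {2..t - 1}" using s(1) explore_subset by blast
    then have "s \<in> {1..<t}" by auto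
    then show ?thesis
      using played_explore[OF assms(1) _ explore_at[OF s(1)], of X] s(2) by (simp add: past_def)
  qed
  then show ?thesis by (simp add: sample_mean_def obs_times_past[OF assms])
qed

text \<open>If arm \<open>n\<close> wins against \<open>b\<close>, any threshold \<open>c\<close> is
  either at most the sample mean of \<open>n\<close> or at least that of \<open>b\<close>. Nonempty
  samples tie \<open>m\<close> to the sample means at both arms. Multiplying by the sample sizes
  gives sums in the form of \<open>chernoff_iid\<close>.\<close>

lemma exploit_error:
  assumes "dsee N (explore N f) d" "t \<ge> 1" "t \<notin> explore N f t" "b \<in> {1..N}"
    and "arm_times N f n t \<noteq> {}" "arm_times N f b t \<noteq> {}" "played d X t \<omega> = n"
  shows "0 \<le> (\<Sum>s\<in>arm_times N f n t. X n s \<omega> - c) \<or> 0 \<le> (\<Sum>s\<in>arm_times N f b t. c - X b s \<omega>)"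
proof -
  have "policy N d" using assms(1) by (simp add: dsee_def)
  then obtain m where m:
      "\<And>n. n \<in> {1..N} \<Longrightarrow> obs_times (explore N f) t (past d X t \<omega>) n \<noteq> {} \<Longrightarrow>
         m n = sample_mean (explore N f) t (past d X t \<omega>) n"
      and max: "is_arg_max m (\<lambda>n. n \<in> {1..N}) (played d X t \<omega>)"
    using assms(1-3) past_in_space[of N d X t \<omega>] unfolding dsee_def played_past by metis
  have n: "n \<in> {1..N}" using max assms(7) by (auto simp: is_arg_max_def)
  have "m b \<le> m n" using max assms(4,7) by (auto simp: is_arg_max_def not_less)
  have fin: "finite (arm_times N f k t)" for k by (simp add: arm_times_def)
  have pos: "real (card (arm_times N f k t)) > 0" if "k = n \<or> k = b" for k
    using that assms(5,6) fin by (auto simp: card_gt_0_iff)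
  have eq: "(\<Sum>s\<in>arm_times N f k t. X k s \<omega>) = m k * real (card (arm_times N f k t))"
    if "k = n \<or> k = b" for k
  proof -
    have "k \<in> {1..N}" "arm_times N f k t \<noteq> {}" using that n assms(4-6) by auto
    then have "m k = (\<Sum>s\<in>arm_times N f k t. X k s \<omega>) / real (card (arm_times N f k t))"
      using m[of k] unfolding obs_times_past[OF assms(1,2)] sample_mean_past[OF assms(1,2)] by simp
    then show ?thesis using pos[OF that] by simp
  qed
  consider "m n \<ge> c" | "m b \<le> c" using \<open>m b \<le> m n\<close> by linarith
  then show ?thesis
  proof cases
    case 1
    then have "0 \<le> (m n - c) * real (card (arm_times N f n t))" by simp
    then show ?thesis using eq[of n] by (simp add: sum_subtractf algebra_simps)
  next
    case 2
    then have "0 \<le> (c - m b) * real (card (arm_times N f b t))" by simp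
    then show ?thesis using eq[of b] by (simp add: sum_subtractf algebra_simps)
  qed
qed

text \<open>A shift only multiplies the exponential by a constant. The two signs serve the upward
  deviation of the worse arm and the downward deviation of the better one.\<close>

lemma light_tailed_shift:
  assumes "light_tailed D (\<lambda>x. x)"
  obtains u0 where "u0 > 0" "integrable D (\<lambda>x. exp (u0 * (x - c)))" "integrable D (\<lambda>x. exp (u0 * (c - x)))"
proof -
  obtain u0 where u0: "u0 > 0" "\<And>u. \<bar>u\<bar> \<le> u0 \<Longrightarrow> integrable D (\<lambda>x. exp (u * x))"
    using assms by (auto simp: light_tailed_def)
  have "integrable D (\<lambda>x. exp (- u0 * c) * exp (u0 * x))" "integrable D (\<lambda>x. exp (u0 * c) * exp (- u0 * x))"
    using u0(2)[of u0] u0(2)[of "- u0"] \<open>u0 > 0\<close> by auto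
  then show thesis
    using that[OF u0(1)] by (simp add: exp_add[symmetric] algebra_simps)
qed

text \<open>Union bound over the two deviations in \<open>exploit_error\<close>, each controlled by
  \<open>chernoff_iid\<close> with the sample size from \<open>card_arm_times\<close>.\<close>

lemma suboptimal_arm_prob:
  assumes n: "n \<in> {1..N}" and b: "b \<in> {1..N}"
    and dist: "\<forall>k\<in>{1..N}. real_distribution (F k)"
    and int: "\<forall>k\<in>{1..N}. integrable (F k) (\<lambda>x. x)"
    and tail: "\<forall>k\<in>{1..N}. light_tailed (F k) (\<lambda>x. x)"
    and less: "mean (F n) < mean (F b)"
    and pos: "\<forall>t\<ge>1. f t > 0"
  obtains a where "a > 0"
    "\<And>(M :: 'a measure) X d t. bandit M N F X \<Longrightarrow> dsee N (explore N f) d \<Longrightarrow> t \<ge> 1 \<Longrightarrow>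
      t \<notin> explore N f t \<Longrightarrow>
      measure M {\<omega> \<in> space M. played d X t \<omega> = n} \<le> 2 * exp (- a * (f t * ln (real t)))"
proof -
  \<comment> \<open>With the midpoint, \<open>x - c\<close> under \<open>F n\<close> and
    \<open>c - x\<close> under \<open>F b\<close> both have mean minus half the gap.\<close>
  define c where "c = (mean (F n) + mean (F b)) / 2"
  interpret Fn: real_distribution "F n" using dist n by simp
  interpret Fb: real_distribution "F b" using dist b by simp
  obtain u where u: "u > 0" "integrable (F n) (\<lambda>x. exp (u * (x - c)))"
    using light_tailed_shift[OF tail[THEN bspec, OF n]] by metis
  obtain v where v: "v > 0" "integrable (F b) (\<lambda>x. exp (v * (c - x)))"
    using light_tailed_shift[OF tail[THEN bspec, OF b]] by metis
  have intn: "integrable (F n) (\<lambda>x. x - c)" "(\<integral>x. x - c \<partial>F n) < 0"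
    using int[THEN bspec, OF n] less by (auto simp: Fn.prob_space[unfolded Fn.space_eq_univ] mean_def[symmetric] c_def field_simps)
  have intb: "integrable (F b) (\<lambda>x. c - x)" "(\<integral>x. c - x \<partial>F b) < 0"
    using int[THEN bspec, OF b] less by (auto simp: Fb.prob_space[unfolded Fb.space_eq_univ] mean_def[symmetric] c_def field_simps)
  obtain a1 where a1: "a1 > 0"
    "\<And>(M :: 'a measure) (Z :: nat \<times> nat \<Rightarrow> 'a \<Rightarrow> real) J. prob_space M \<Longrightarrow> finite J \<Longrightarrow>
       prob_space.indep_vars M (\<lambda>_. borel) Z J \<Longrightarrow> (\<And>i. i \<in> J \<Longrightarrow> distr M borel (Z i) = F n) \<Longrightarrow>
       measure M {\<omega> \<in> space M. 0 \<le> (\<Sum>i\<in>J. Z i \<omega> - c)} \<le> exp (- a1 * real (card J))"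
    by (rule chernoff_iid[OF dist[THEN bspec, OF n] _ intn u]) (measurable, blast)
  obtain a2 where a2: "a2 > 0"
    "\<And>(M :: 'a measure) (Z :: nat \<times> nat \<Rightarrow> 'a \<Rightarrow> real) J. prob_space M \<Longrightarrow> finite J \<Longrightarrow>
       prob_space.indep_vars M (\<lambda>_. borel) Z J \<Longrightarrow> (\<And>i. i \<in> J \<Longrightarrow> distr M borel (Z i) = F b) \<Longrightarrow>
       measure M {\<omega> \<in> space M. 0 \<le> (\<Sum>i\<in>J. c - Z i \<omega>)} \<le> exp (- a2 * real (card J))"
    by (rule chernoff_iid[OF dist[THEN bspec, OF b] _ intb v]) (measurable, blast)
  show thesis
  proof (rule that[of "min a1 a2"])
    show "min a1 a2 > 0" using a1(1) a2(1) by simp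
  next
    fix M :: "'a measure" and X d t
    assume bandit: "bandit M N F X" and dsee: "dsee N (explore N f) d"
      and t: "t \<ge> 1" "t \<notin> explore N f t"
    interpret bandit_policy M N F X d
    proof (intro bandit_policy.intro bandit_policy_axioms.intro)
      show "prob_space M" "bandit M N F X" "policy N d"
        using bandit dsee by (simp_all add: bandit_def dsee_def)
    qed (use int in blast)
    show "arm_prob n t \<le> 2 * exp (- min a1 a2 * (f t * ln (real t)))"
    proof (cases "t = 1")
      \<comment> \<open>Time 1 has no samples, but \<open>ln 1 = 0\<close> makes the bound equal to
        2.\<close>
      case True
      then show ?thesis by (intro order_trans[OF prob_le_1]) simp
    next
      case False
      with t have "t \<ge> 2" by simp
      define S where "S k = arm_times N f k t" for k
      have fin: "finite (S k)" for k by (simp add: S_def arm_times_def)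
      have S1: "s \<ge> 1" if "s \<in> S k" for s k
        using that explore_subset[of N f "t - 1"] by (force simp: S_def arm_times_def)
      have card: "f t * ln (real t) \<le> real (card (S k))" if "k \<in> {1..N}" for k
        unfolding S_def using that \<open>t \<ge> 2\<close> t(2) by (rule card_arm_times)
      \<comment> \<open>A positive lower bound on the sample sizes makes the samples
        nonempty.\<close>
      have "f t * ln (real t) > 0" using pos \<open>t \<ge> 2\<close> by simp
      then have ne: "S k \<noteq> {}" if "k \<in> {1..N}" for k
        using card[OF that] by auto
      have ind: "indep_vars (\<lambda>_. borel) (\<lambda>(n, t). X n t) ({k} \<times> S k)" if "k \<in> {1..N}" for k
        by (rule indep_vars_subset[OF indep_rewards]) (use that S1 in auto)
      have distr: "distr M borel ((\<lambda>(n, t). X n t) i) = F k" if k: "k \<in> {1..N}" and i: "i \<in> {k} \<times> S k" for k i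
      proof -
        obtain s where "i = (k, s)" "s \<in> S k" using i by blast
        then show ?thesis using distr_reward[OF k S1[of s k]] by simp
      qed
      have meas: "X k s \<in> borel_measurable M" if "k \<in> {1..N}" "s \<in> S k" for k s
        using measurable_reward[OF that(1) S1[OF that(2)]] .
      \<comment> \<open>Independence is stated for pairs of arm and time; this reindexes the sums by
        time.\<close>
      have pair_eq: "{k} \<times> S k = Pair k ` S k" for k by auto
      let ?E1 = "{\<omega> \<in> space M. 0 \<le> (\<Sum>s\<in>S n. X n s \<omega> - c)}"
      let ?E2 = "{\<omega> \<in> space M. 0 \<le> (\<Sum>s\<in>S b. c - X b s \<omega>)}"
      have E1: "prob ?E1 \<le> exp (- a1 * real (card (S n)))"
      proof -
        have "prob {\<omega> \<in> space M. 0 \<le> (\<Sum>i\<in>{n} \<times> S n. (case i of (n, t) \<Rightarrow> X n t) \<omega> - c)}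
            \<le> exp (- a1 * real (card ({n} \<times> S n)))"
          by (rule a1(2)[OF prob_space_axioms _ ind[OF n]]) (use fin distr[OF n] in blast)+
        then show ?thesis
          unfolding pair_eq by (simp add: sum.reindex card_image inj_on_def)
      qed
      have E2: "prob ?E2 \<le> exp (- a2 * real (card (S b)))"
      proof -
        have "prob {\<omega> \<in> space M. 0 \<le> (\<Sum>i\<in>{b} \<times> S b. c - (case i of (n, t) \<Rightarrow> X n t) \<omega>)}
            \<le> exp (- a2 * real (card ({b} \<times> S b)))"
          by (rule a2(2)[OF prob_space_axioms _ ind[OF b]]) (use fin distr[OF b] in blast)+
        then show ?thesis
          unfolding pair_eq by (simp add: sum.reindex card_image inj_on_def)
      qed
      have ev: "?E1 \<in> events" "?E2 \<in> events"
        by (intro borel_measurable_le borel_measurable_sum borel_measurable_diff borel_measurable_const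
            meas[OF n] meas[OF b]; assumption)+
      have "arm_prob n t \<le> prob (?E1 \<union> ?E2)"
      proof (rule finite_measure_mono)
        show "{\<omega> \<in> space M. played d X t \<omega> = n} \<subseteq> ?E1 \<union> ?E2"
        proof
          fix \<omega> assume "\<omega> \<in> {\<omega> \<in> space M. played d X t \<omega> = n}"
          then show "\<omega> \<in> ?E1 \<union> ?E2"
            using exploit_error[OF dsee t b ne[OF n, unfolded S_def] ne[OF b, unfolded S_def], of X \<omega> c]
            by (simp add: S_def)
        qed
        show "?E1 \<union> ?E2 \<in> events" using ev by (rule sets.Un)
      qed
      also have "\<dots> \<le> prob ?E1 + prob ?E2"
        using ev by (rule measure_Un_le)
      also have "\<dots> \<le> exp (- a1 * real (card (S n))) + exp (- a2 * real (card (S b)))"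
        using E1 E2 by (rule add_mono)
      also have "\<dots> \<le> exp (- min a1 a2 * (f t * ln (real t))) + exp (- min a1 a2 * (f t * ln (real t)))"
      proof (rule add_mono)
        have "min a1 a2 * (f t * ln (real t)) \<le> a1 * real (card (S n))"
          by (rule mult_mono) (use card[OF n] a1(1) \<open>f t * ln (real t) > 0\<close> in auto)
        then show "exp (- a1 * real (card (S n))) \<le> exp (- min a1 a2 * (f t * ln (real t)))" by simp
        have "min a1 a2 * (f t * ln (real t)) \<le> a2 * real (card (S b))"
          by (rule mult_mono) (use card[OF b] a2(1) \<open>f t * ln (real t) > 0\<close> in auto)
        then show "exp (- a2 * real (card (S b))) \<le> exp (- min a1 a2 * (f t * ln (real t)))" by simp
      qed
      finally show ?thesis by simp
    qed
  qed
qed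

text \<open>However small \<open>a\<close> is, eventually \<open>a * f t \<ge> 2\<close>, and then
  the term is at most \<open>inverse (real t ^ 2)\<close>.\<close>

lemma summable_exp_mult_ln:
  assumes "filterlim f at_top sequentially" "a > (0::real)"
  shows "summable (\<lambda>t. exp (- a * (f t * ln (real t))))"
proof (rule summable_comparison_test_ev)
  have "\<forall>\<^sub>F t in sequentially. f t \<ge> 2 / a"
    using assms(1) by (auto simp: filterlim_at_top)
  then show "\<forall>\<^sub>F t in sequentially. norm (exp (- a * (f t * ln (real t)))) \<le> inverse (real t ^ 2)"
    using eventually_ge_at_top[of 1]
  proof eventually_elim
    case (elim t)
    have "2 * ln (real t) \<le> (a * f t) * ln (real t)"
      using elim \<open>a > 0\<close> by (intro mult_right_mono) (auto simp: field_simps)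
    then have "exp (- a * (f t * ln (real t))) \<le> exp (- (2 * ln (real t)))"
      by (simp add: mult.assoc)
    also have "\<dots> = inverse (real t ^ 2)"
      using elim by (simp add: exp_minus exp_double)
    finally show ?case by simp
  qed
qed (rule inverse_power_summable, simp)

text \<open>\<open>K\<close> is the sum of the series of error bounds, chosen before
  \<open>M\<close>, \<open>X\<close>, \<open>d\<close> and \<open>T\<close>.\<close>

lemma sum_suboptimal_arm_prob:
  assumes n: "n \<in> {1..N}" and b: "b \<in> {1..N}"
    and "\<forall>k\<in>{1..N}. real_distribution (F k)"
    and "\<forall>k\<in>{1..N}. integrable (F k) (\<lambda>x. x)"
    and "\<forall>k\<in>{1..N}. light_tailed (F k) (\<lambda>x. x)"
    and "mean (F n) < mean (F b)"
    and "\<forall>t\<ge>1. f t > 0"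
    and lim: "filterlim f at_top sequentially"
  obtains K where "K \<ge> 0"
    "\<And>(M :: 'a measure) X d T. bandit M N F X \<Longrightarrow> dsee N (explore N f) d \<Longrightarrow>
      (\<Sum>t=1..T. measure M {\<omega> \<in> space M. played d X t \<omega> = n}) \<le> real (card (explore N f T)) + K"
proof -
  obtain a where a: "a > 0"
    "\<And>(M :: 'a measure) X d t. bandit M N F X \<Longrightarrow> dsee N (explore N f) d \<Longrightarrow> t \<ge> 1 \<Longrightarrow>
      t \<notin> explore N f t \<Longrightarrow>
      measure M {\<omega> \<in> space M. played d X t \<omega> = n} \<le> 2 * exp (- a * (f t * ln (real t)))"
    using suboptimal_arm_prob[OF assms(1-7)] by blast
  let ?e = "\<lambda>t. 2 * exp (- a * (f t * ln (real t)))"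
  have sum: "summable ?e" using summable_exp_mult_ln[OF lim a(1)] by (rule summable_mult)
  show thesis
  proof (rule that[of "\<Sum>t. ?e t"])
    show "(\<Sum>t. ?e t) \<ge> 0" using sum by (rule suminf_nonneg) simp
  next
    fix M :: "'a measure" and X d T
    assume bd: "bandit M N F X" "dsee N (explore N f) d"
    interpret prob_space M using bd by (simp add: bandit_def)
    let ?p = "\<lambda>t. prob {\<omega> \<in> space M. played d X t \<omega> = n}"
    \<comment> \<open>The indicator pays for exploration times, where the probability is only
      bounded by 1.\<close>
    have "?p t \<le> indicator (explore N f T) t + ?e t" if "t \<in> {1..T}" for t
    proof (cases "t \<in> explore N f t")
      case True
      then have "t \<in> explore N f T" using explore_mono[of t T N f] that by auto
      then show ?thesis by (simp add: add_increasing2)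
    next
      case False
      with a(2)[OF bd _ False] that have "?p t \<le> ?e t" by simp
      then show ?thesis by (rule add_increasing[rotated]) simp
    qed
    then have "(\<Sum>t=1..T. ?p t) \<le> (\<Sum>t=1..T. indicator (explore N f T) t + ?e t)"
      by (rule sum_mono)
    also have "\<dots> = real (card (explore N f T \<inter> {1..T})) + (\<Sum>t=1..T. ?e t)"
      by (simp add: sum.distrib sum.inter_restrict[symmetric] indicator_def sum.If_cases Int_commute)
    also have "\<dots> \<le> real (card (explore N f T)) + (\<Sum>t. ?e t)"
      by (intro add_mono sum_le_suminf sum) (auto intro: card_mono)
    finally show "(\<Sum>t=1..T. ?p t) \<le> real (card (explore N f T)) + (\<Sum>t. ?e t)" .
  qed
qed

section \<open>Assembling the regret bound\<close>

theorem theorem2: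
  fixes N :: nat and F :: "nat \<Rightarrow> real measure" and f :: "nat \<Rightarrow> real" and \<sigma> :: "nat \<Rightarrow> nat"
  assumes "N \<ge> 2"
    and "\<And>n. n \<in> {1..N} \<Longrightarrow> real_distribution (F n)"
    and "\<And>n. n \<in> {1..N} \<Longrightarrow> integrable (F n) (\<lambda>x. x)"
    and "\<And>n. n \<in> {1..N} \<Longrightarrow> light_tailed (F n) (\<lambda>x. x)"
    and "\<sigma> permutes {1..N}"
    and "\<And>i j. 1 \<le> i \<Longrightarrow> i \<le> j \<Longrightarrow> j \<le> N \<Longrightarrow> mean (F (\<sigma> i)) \<ge> mean (F (\<sigma> j))"
    and "\<And>t. t \<ge> 1 \<Longrightarrow> f t > 0"
    and "mono_on {1..} f"
    and "filterlim f at_top sequentially"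
  shows "\<exists>C. \<forall>\<^sub>F T in sequentially.
           \<forall>(M :: 'a measure) X d. bandit M N F X \<longrightarrow> dsee N (explore N f) d \<longrightarrow>
             \<bar>regret M X (mean (F (\<sigma> 1))) d T\<bar> \<le> C * \<bar>f T * ln (real T)\<bar>"
proof -
  define b where "b = \<sigma> 1"
  have b: "b \<in> {1..N}" using assms(1,5) permutes_in_image[of \<sigma> "{1..N}" 1] by (simp add: b_def)
  have best: "mean (F n) \<le> mean (F b)" if n: "n \<in> {1..N}" for n
  proof -
    obtain i where "i \<in> {1..N}" "n = \<sigma> i" using n permutes_image[OF assms(5)] by blast
    then show ?thesis using assms(6)[of 1 i] by (simp add: b_def)
  qed
  define \<Delta> where "\<Delta> n = mean (F b) - mean (F n)" for n
  have \<Delta>: "\<Delta> n \<ge> 0" if "n \<in> {1..N}" for n using best[OF that] by (simp add: \<Delta>_def)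
  \<comment> \<open>An arm tied with \<open>b\<close> may be played arbitrarily often. The factor
    \<open>\<Delta> n = 0\<close> removes it, so the same form of bound covers all arms.\<close>
  have "\<exists>K. K \<ge> 0 \<and> (\<forall>(M :: 'a measure) X d T. bandit M N F X \<longrightarrow> dsee N (explore N f) d \<longrightarrow>
      \<Delta> n * (\<Sum>t=1..T. measure M {\<omega> \<in> space M. played d X t \<omega> = n})
        \<le> \<Delta> n * (real (card (explore N f T)) + K))" if n: "n \<in> {1..N}" for n
  proof (cases "\<Delta> n = 0")
    case True
    then show ?thesis by auto
  next
    case False
    with \<Delta>[OF n] have "mean (F n) < mean (F b)" by (simp add: \<Delta>_def)
    from sum_suboptimal_arm_prob[OF n b _ _ _ this _ assms(9)] assms(2-4,7) obtain K where
      "K \<ge> 0" "\<And>(M :: 'a measure) X d T. bandit M N F X \<Longrightarrow> dsee N (explore N f) d \<Longrightarrow>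
      (\<Sum>t=1..T. measure M {\<omega> \<in> space M. played d X t \<omega> = n}) \<le> real (card (explore N f T)) + K"
      by blast
    then show ?thesis using \<Delta>[OF n] by (intro exI[of _ K]) (auto intro: mult_left_mono)
  qed
  then have "\<forall>n\<in>{1..N}. \<exists>K. K \<ge> 0 \<and> (\<forall>(M :: 'a measure) X d T. bandit M N F X \<longrightarrow>
      dsee N (explore N f) d \<longrightarrow> \<Delta> n * (\<Sum>t=1..T. measure M {\<omega> \<in> space M. played d X t \<omega> = n})
        \<le> \<Delta> n * (real (card (explore N f T)) + K))"
    by (rule ballI)
  from bchoice[OF this] obtain K where K: "\<And>n. n \<in> {1..N} \<Longrightarrow> K n \<ge> 0"
    "\<And>n (M :: 'a measure) X d T. n \<in> {1..N} \<Longrightarrow> bandit M N F X \<Longrightarrow> dsee N (explore N f) d \<Longrightarrow>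
      \<Delta> n * (\<Sum>t=1..T. measure M {\<omega> \<in> space M. played d X t \<omega> = n})
        \<le> \<Delta> n * (real (card (explore N f T)) + K n)"
    by blast
  \<comment> \<open>\<open>2 * real N\<close> accounts for exploration, where the ceiling at most
    doubles \<open>g\<close>, and \<open>K n\<close> for the errors in exploitation.\<close>
  define C where "C = (\<Sum>n=1..N. \<Delta> n * (2 * real N + K n))"
  \<comment> \<open>For large \<open>T\<close> both factors, hence also \<open>g\<close>, are at
    least 1, so constants can be absorbed into multiples of \<open>g\<close>.\<close>
  have "\<forall>\<^sub>F T in sequentially. f T \<ge> 1"
    using assms(9) by (auto simp: filterlim_at_top)
  moreover have "\<forall>\<^sub>F T in sequentially. ln (real T) \<ge> 1"
    using filterlim_compose[OF ln_at_top filterlim_real_sequentially] by (auto simp: filterlim_at_top)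
  ultimately have "\<forall>\<^sub>F T in sequentially. \<forall>(M :: 'a measure) X d. bandit M N F X \<longrightarrow>
      dsee N (explore N f) d \<longrightarrow> \<bar>regret M X (mean (F b)) d T\<bar> \<le> C * \<bar>f T * ln (real T)\<bar>"
    using eventually_ge_at_top[of 1]
  proof eventually_elim
    case (elim T)
    define g where "g = f T * ln (real T)"
    have g: "g \<ge> 1" using mult_mono[of 1 "f T" 1 "ln (real T)"] elim by (simp add: g_def)
    have "int (card (explore N f T)) \<le> int N * \<lceil>g\<rceil>"
      unfolding g_def using assms(7,8) elim by (intro card_explore_le) auto
    then have "real (card (explore N f T)) \<le> real N * real_of_int \<lceil>g\<rceil>"
      by (metis of_int_le_iff of_int_mult of_int_of_nat_eq)
    also have "\<dots> \<le> real N * (2 * g)"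
      \<comment> \<open>The ceiling of \<open>g\<close> is below \<open>g + 1\<close>, which is at
        most \<open>2 * g\<close>.\<close>
      using g by (intro mult_left_mono) linarith+
    finally have card: "real (card (explore N f T)) \<le> 2 * real N * g" by simp
    show ?case
    proof (intro allI impI)
      fix M :: "'a measure" and X d
      assume bd: "bandit M N F X" "dsee N (explore N f) d"
      interpret bandit_policy M N F X d
      proof (intro bandit_policy.intro bandit_policy_axioms.intro)
        show "prob_space M" "bandit M N F X" "policy N d"
          using bd by (simp_all add: bandit_def dsee_def)
      qed (rule assms(3))
      have eq: "regret M X (mean (F b)) d T = (\<Sum>n=1..N. \<Delta> n * (\<Sum>t=1..T. arm_prob n t))"
        by (simp add: regret_eq \<Delta>_def)
      \<comment> \<open>All gaps to the best arm are nonnegative; this handles the absolute value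
        from below.\<close>
      have "0 \<le> regret M X (mean (F b)) d T"
        unfolding eq using \<Delta> by (intro sum_nonneg mult_nonneg_nonneg) auto
      moreover have "regret M X (mean (F b)) d T \<le> C * g"
        unfolding eq C_def sum_distrib_right
      proof (rule sum_mono)
        fix n assume n: "n \<in> {1..N}"
        have "\<Delta> n * (\<Sum>t=1..T. arm_prob n t) \<le> \<Delta> n * (real (card (explore N f T)) + K n)"
          by (rule K(2)[OF n bd])
        also have "\<dots> \<le> \<Delta> n * ((2 * real N + K n) * g)"
        proof (rule mult_left_mono[OF _ \<Delta>[OF n]])
          have "K n * 1 \<le> K n * g" using K(1)[OF n] g by (intro mult_left_mono) auto
          then show "real (card (explore N f T)) + K n \<le> (2 * real N + K n) * g"
            using card by (simp add: distrib_right)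
        qed
        finally show "\<Delta> n * (\<Sum>t=1..T. arm_prob n t) \<le> \<Delta> n * (2 * real N + K n) * g"
          by (simp add: mult.assoc)
      qed
      ultimately show "\<bar>regret M X (mean (F b)) d T\<bar> \<le> C * \<bar>f T * ln (real T)\<bar>"
        using g unfolding g_def[symmetric] by simp
    qed
  qed
  then show ?thesis unfolding b_def by blast
qed

end
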